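(* Let $\mathcal{A}$ be a $C^*$-algebra which is not unital but is locally unital. Then $\mathcal{A}$ (as a Hilbert $C^*$-module) cannot be represented as an orthogonal direct summand of a standard module $\bigoplus_{\lambda\in\Lambda}\dot{\mathcal{A}}$, for any index set $\Lambda$.
   Context: A self-adjoint element $h\in\mathcal{A}$ is a local unit for $a\in\mathcal{A}$ if $ah=ha=a$. A $C^*$-algebra $\mathcal{A}$ is locally unital if every $a\in\mathcal{A}$ has a local unit in $\mathcal{A}$. $\dot{\mathcal{A}}$ denotes the unitalization of $\mathcal{A}$. $\mathcal{A}$ is regarded as a right Hilbert module over $\dot{\mathcal{A}}$ with inner product $\langle a,b\rangle=a^*b$. $\bigoplus_{\lambda\in\Lambda}\dot{\mathcal{A}}$ is the Hilbert sum of copies of $\dot{\mathcal{A}}$, i.e. the Hilbert $\dot{\mathcal{A}}$-module of families $(a_\lambda)_{\lambda\in\Lambda}$ with $\sum_\lambda a_\lambda^*a_\lambda$ norm convergent, with inner product $\langle (a_\lambda),(b_\lambda)\rangle=\sum_\lambda a_\lambda^*b_\lambda$. That $\mathcal{A}$ is an orthogonal direct summand means that there is a Hilbert $\dot{\mathcal{A}}$-module $\mathcal{N}$ such that $\mathcal{A}\oplus\mathcal{N}$ is isomorphic to $\bigoplus_{\lambda\in\Lambda}\dot{\mathcal{A}}$ as Hilbert $\dot{\mathcal{A}}$-modules (inner products preserved). *)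

theory Defs
  imports "HOL-Analysis.Analysis"
begin

section \<open>C*-algebras\<close>

text \<open>
  Complex C*-algebras, not necessarily unital. The law \<open>1 *\<^sub>C x = x\<close> is the
  case \<open>r = 1\<close> of \<open>scaleR_scaleC\<close>.
\<close>

class cstar_algebra = real_normed_algebra + banach +
  fixes scaleC :: "complex \<Rightarrow> 'a \<Rightarrow> 'a"  (infixr \<open>*\<^sub>C\<close> 75)
    and star :: "'a \<Rightarrow> 'a"
  assumes scaleC_add_right: "c *\<^sub>C (x + y) = c *\<^sub>C x + c *\<^sub>C y"
    and scaleC_add_left: "(c + d) *\<^sub>C x = c *\<^sub>C x + d *\<^sub>C x"
    and scaleC_scaleC: "c *\<^sub>C (d *\<^sub>C x) = (c * d) *\<^sub>C x"
    and scaleR_scaleC: "r *\<^sub>R x = complex_of_real r *\<^sub>C x"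
    and mult_scaleC_left: "(c *\<^sub>C x) * y = c *\<^sub>C (x * y)"
    and mult_scaleC_right: "x * (c *\<^sub>C y) = c *\<^sub>C (x * y)"
    and norm_scaleC: "norm (c *\<^sub>C x) = cmod c * norm x"
    and star_star: "star (star x) = x"
    and star_add: "star (x + y) = star x + star y"
    and star_scaleC: "star (c *\<^sub>C x) = cnj c *\<^sub>C star x"
    and star_mult: "star (x * y) = star y * star x"
    and cstar_identity: "norm (star x * x) = (norm x)\<^sup>2"

class unital_cstar_algebra = cstar_algebra + real_normed_algebra_1

definition unital :: "'a::cstar_algebra itself \<Rightarrow> bool" where
  "unital _ \<longleftrightarrow> (\<exists>e::'a. \<forall>a. e * a = a \<and> a * e = a)"

definition local_unit :: "'a::cstar_algebra \<Rightarrow> 'a \<Rightarrow> bool" where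
  "local_unit h a \<longleftrightarrow> star h = h \<and> a * h = a \<and> h * a = a"

definition locally_unital :: "'a::cstar_algebra itself \<Rightarrow> bool" where
  "locally_unital _ \<longleftrightarrow> (\<forall>a::'a. \<exists>h. local_unit h a)"

definition spectrum :: "'a::unital_cstar_algebra \<Rightarrow> complex set" where
  "spectrum x = {c. \<not> (\<exists>y. (x - c *\<^sub>C 1) * y = 1 \<and> y * (x - c *\<^sub>C 1) = 1)}"

definition cstar_positive :: "'a::unital_cstar_algebra \<Rightarrow> bool" where
  "cstar_positive x \<longleftrightarrow> star x = x \<and> spectrum x \<subseteq> \<real>\<^sub>\<ge>\<^sub>0"

lemma scaleC_one [simp]: "1 *\<^sub>C x = (x::'a::cstar_algebra)"
  using scaleR_scaleC[of 1 x] by simp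

lemma scaleC_zero_left [simp]: "0 *\<^sub>C x = (0::'a::cstar_algebra)"
  using scaleC_add_left[of 0 0 x] by simp

lemma scaleC_zero_right [simp]: "c *\<^sub>C 0 = (0::'a::cstar_algebra)"
  using scaleC_add_right[of c 0 "0::'a"] by simp

lemma scaleC_minus_left: "(- c) *\<^sub>C x = - (c *\<^sub>C (x::'a::cstar_algebra))"
  using scaleC_add_left[of "- c" c x] by (simp add: eq_neg_iff_add_eq_0)

lemma scaleC_scaleR_commute: "c *\<^sub>C (r *\<^sub>R x) = r *\<^sub>R (c *\<^sub>C (x::'a::cstar_algebra))"
  by (simp add: scaleR_scaleC scaleC_scaleC mult.commute)

lemma star_zero [simp]: "star 0 = (0::'a::cstar_algebra)"
  using star_add[of 0 "0::'a"] by simp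

lemma norm_star [simp]: "norm (star x) = norm (x::'a::cstar_algebra)"
proof -
  have le: "norm y \<le> norm (star y)" for y :: 'a
  proof (cases "y = 0")
    case False
    have "norm y * norm y \<le> norm (star y) * norm y"
      using norm_mult_ineq[of "star y" y] by (simp add: cstar_identity power2_eq_square)
    then show ?thesis using False by simp
  qed simp
  from le[of x] le[of "star x"] show ?thesis by (simp add: star_star)
qed

section \<open>Unitalization\<close>

text \<open>
  \<open>Unitization a c\<close> stands for the formal sum \<open>a + c 1\<close>.
\<close>

datatype 'a unitization = Unitization (alg_part: 'a) (scal_part: complex)

definition left_mult :: "'a::cstar_algebra unitization \<Rightarrow> 'a \<Rightarrow> 'a" where
  "left_mult u b = alg_part u * b + scal_part u *\<^sub>C b"

instantiation unitization :: (cstar_algebra) real_algebra_1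
begin

definition "0 = Unitization 0 0"
definition "1 = Unitization 0 1"
definition "u + v = Unitization (alg_part u + alg_part v) (scal_part u + scal_part v)"
definition "- u = Unitization (- alg_part u) (- scal_part u)"
definition "u - v = Unitization (alg_part u - alg_part v) (scal_part u - scal_part v)"
definition "u * v = Unitization
  (alg_part u * alg_part v + scal_part u *\<^sub>C alg_part v + scal_part v *\<^sub>C alg_part u)
  (scal_part u * scal_part v)"
definition "r *\<^sub>R u = Unitization (r *\<^sub>R alg_part u) (r *\<^sub>R scal_part u)"

lemma unitization_parts [simp]:
  "alg_part (0::'a unitization) = 0" "scal_part (0::'a unitization) = 0"
  "alg_part (1::'a unitization) = 0" "scal_part (1::'a unitization) = 1"
  "alg_part (u + v) = alg_part u + alg_part v" "scal_part (u + v) = scal_part u + scal_part v"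
  "alg_part (- u) = - alg_part u" "scal_part (- u) = - scal_part u"
  "alg_part (u - v) = alg_part u - alg_part v" "scal_part (u - v) = scal_part u - scal_part v"
  "alg_part (u * v) = alg_part u * alg_part v + scal_part u *\<^sub>C alg_part v + scal_part v *\<^sub>C alg_part u"
  "scal_part (u * v) = scal_part u * scal_part v"
  "alg_part (r *\<^sub>R u) = r *\<^sub>R alg_part u" "scal_part (r *\<^sub>R u) = r *\<^sub>R scal_part u"
  for u v :: "'a unitization"
  by (simp_all add: zero_unitization_def one_unitization_def plus_unitization_def
      uminus_unitization_def minus_unitization_def times_unitization_def scaleR_unitization_def)

instance
proof
  fix u v w :: "'a unitization" and r s :: real
  show "u * v * w = u * (v * w)"
    by (rule unitization.expand)
      (simp add: algebra_simps mult_scaleC_left mult_scaleC_right scaleC_add_right scaleC_scaleC)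
  show "(u + v) * w = u * w + v * w" "u * (v + w) = u * v + u * w"
    by (rule unitization.expand, simp add: algebra_simps scaleC_add_right scaleC_add_left)+
  show "r *\<^sub>R u * v = r *\<^sub>R (u * v)" "u * r *\<^sub>R v = r *\<^sub>R (u * v)"
    by (rule unitization.expand, simp add: scaleR_scaleC scaleC_add_right scaleC_scaleC
        mult_scaleC_left mult_scaleC_right scaleR_conv_of_real[where 'a = complex] mult_ac)+
  show "u + v + w = u + (v + w)" "u + v = v + u" "0 + u = u" "- u + u = 0"
    "u - v = u + - v" "1 * u = u" "u * 1 = u"
    "r *\<^sub>R (u + v) = r *\<^sub>R u + r *\<^sub>R v" "(r + s) *\<^sub>R u = r *\<^sub>R u + s *\<^sub>R u"
    "r *\<^sub>R s *\<^sub>R u = (r * s) *\<^sub>R u" "1 *\<^sub>R u = u"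
    by (rule unitization.expand, simp add: algebra_simps)+
  show "(0::'a unitization) \<noteq> 1"
    by (metis unitization_parts(2,4) zero_neq_one)
qed

end

lemma bounded_linear_left_mult: "bounded_linear (left_mult u)"
proof (rule bounded_linear_intro)
  fix x y and r :: real
  show "left_mult u (x + y) = left_mult u x + left_mult u y"
    by (simp add: left_mult_def algebra_simps scaleC_add_right)
  show "left_mult u (r *\<^sub>R x) = r *\<^sub>R left_mult u x"
    by (simp add: left_mult_def scaleR_add_right scaleC_scaleR_commute)
  have "norm (left_mult u x) \<le> norm (alg_part u * x) + norm (scal_part u *\<^sub>C x)"
    unfolding left_mult_def by (rule norm_triangle_ineq)
  also have "\<dots> \<le> norm (alg_part u) * norm x + cmod (scal_part u) * norm x"
    by (simp add: norm_scaleC norm_mult_ineq)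
  finally show "norm (left_mult u x) \<le> norm x * (norm (alg_part u) + cmod (scal_part u))"
    by (simp add: algebra_simps)
qed

text \<open>
  The norm of the unitalization of a non-unital C*-algebra is the operator norm of left
  multiplication on the algebra. Taking the maximum with the modulus of the scalar part
  changes nothing in that case (\<open>norm_unitization_nonunital\<close> below), and when the algebra
  is unital it turns what would only be a seminorm into the C*-norm, so that the type is
  always a C*-algebra.
\<close>

instantiation unitization :: (cstar_algebra) real_normed_vector
begin

definition "norm u = max (onorm (left_mult u)) (cmod (scal_part u))"
definition "dist u v = norm (u - v)" for u v :: "'a unitization"
definition "sgn u = u /\<^sub>R norm u" for u :: "'a unitization"
definition uniformity_unitization :: "('a unitization \<times> 'a unitization) filter" where
  "uniformity_unitization = (INF e\<in>{0 <..}. principal {(x, y). dist x y < e})"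
definition open_unitization :: "'a unitization set \<Rightarrow> bool" where
  "open_unitization U \<longleftrightarrow> (\<forall>x\<in>U. eventually (\<lambda>(x', y). x' = x \<longrightarrow> y \<in> U) uniformity)"

instance
proof
  fix u v :: "'a unitization" and r :: real
  show "sgn u = u /\<^sub>R norm u" by (rule sgn_unitization_def)
  show "dist u v = norm (u - v)" by (rule dist_unitization_def)
  show "(uniformity :: ('a unitization \<times> 'a unitization) filter)
      = (INF e\<in>{0 <..}. principal {(x, y). dist x y < e})"
    by (rule uniformity_unitization_def)
  show "open U \<longleftrightarrow> (\<forall>x\<in>U. eventually (\<lambda>(x', y). x' = x \<longrightarrow> y \<in> U) uniformity)"
    for U :: "'a unitization set" by (rule open_unitization_def)
  show "norm u = 0 \<longleftrightarrow> u = 0"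
  proof
    assume n: "norm u = 0"
    have ge: "onorm (left_mult u) \<ge> 0"
      by (rule onorm_pos_le[OF bounded_linear_left_mult])
    from n have s: "scal_part u = 0" and o: "onorm (left_mult u) = 0"
      using ge norm_ge_zero[of "scal_part u"] unfolding norm_unitization_def by (auto simp: max_def split: if_splits)
    have "\<forall>x. left_mult u x = 0"
      using o onorm_eq_0[OF bounded_linear_left_mult] by blast
    then have "star (star (alg_part u)) * star (alg_part u) = 0"
      using s by (simp add: left_mult_def star_star)
    then have "norm (star (alg_part u)) = 0"
      using cstar_identity[of "star (alg_part u)"] by simp
    then have "alg_part u = 0" by simp
    with s show "u = 0" by (intro unitization.expand) simp
  next
    assume "u = 0"
    then show "norm u = 0" by (simp add: norm_unitization_def left_mult_def[abs_def] onorm_zero)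
  qed
  have lm_add: "left_mult (u + v) = (\<lambda>x. left_mult u x + left_mult v x)"
    by (rule ext) (simp add: left_mult_def algebra_simps scaleC_add_left)
  have 1: "onorm (left_mult (u + v)) \<le> onorm (left_mult u) + onorm (left_mult v)"
    unfolding lm_add by (intro onorm_triangle bounded_linear_left_mult)
  have 2: "cmod (scal_part (u + v)) \<le> cmod (scal_part u) + cmod (scal_part v)"
    by (simp add: norm_triangle_ineq)
  show "norm (u + v) \<le> norm u + norm v"
    using 1 2 unfolding norm_unitization_def by linarith
  have "left_mult (r *\<^sub>R u) = (\<lambda>x. r *\<^sub>R left_mult u x)"
    by (rule ext) (simp add: left_mult_def scaleR_scaleC scaleC_add_right scaleC_scaleC
        mult_scaleC_left scaleR_conv_of_real[where 'a = complex])
  then have "onorm (left_mult (r *\<^sub>R u)) = \<bar>r\<bar> * onorm (left_mult u)"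
    using onorm_scaleR[OF bounded_linear_left_mult] by simp
  then show "norm (r *\<^sub>R u) = \<bar>r\<bar> * norm u"
    unfolding norm_unitization_def by (simp add: max_mult_distrib_left)
qed

end

lemma scal_part_le_norm: "cmod (scal_part u) \<le> norm u"
  by (simp add: norm_unitization_def)

lemma norm_left_mult_le: "norm (left_mult u x) \<le> onorm (left_mult u) * norm x"
  by (rule onorm[OF bounded_linear_left_mult])

lemma left_mult_mult: "left_mult (u * v) = left_mult u \<circ> left_mult v"
  by (rule ext) (simp add: left_mult_def algebra_simps mult_scaleC_left mult_scaleC_right
      scaleC_add_right scaleC_scaleC)

lemma norm_unitization_embed [simp]: "norm (Unitization a 0) = norm (a::'a::cstar_algebra)"
proof (rule antisym)
  have "onorm (left_mult (Unitization a 0)) \<le> norm a"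
    by (rule onorm_bound) (simp_all add: left_mult_def norm_mult_ineq)
  then show "norm (Unitization a 0) \<le> norm a" by (simp add: norm_unitization_def)
  show "norm a \<le> norm (Unitization a 0)"
  proof (cases "a = 0")
    case False
    have "norm a * norm a = norm (left_mult (Unitization a 0) (star a))"
      using cstar_identity[of "star a"] by (simp add: left_mult_def star_star power2_eq_square)
    also have "\<dots> \<le> onorm (left_mult (Unitization a 0)) * norm a"
      using norm_left_mult_le[of "Unitization a 0" "star a"] by simp
    finally have "norm a \<le> onorm (left_mult (Unitization a 0))" using False by simp
    then show ?thesis by (simp add: norm_unitization_def)
  qed simp
qed

instantiation unitization :: (cstar_algebra) unital_cstar_algebra
begin

definition "c *\<^sub>C u = Unitization (c *\<^sub>C alg_part u) (c * scal_part u)"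
definition "star u = Unitization (star (alg_part u)) (cnj (scal_part u))"

lemma unitization_parts' [simp]:
  "alg_part (c *\<^sub>C u) = c *\<^sub>C alg_part u" "scal_part (c *\<^sub>C u) = c * scal_part u"
  "alg_part (star u) = star (alg_part u)" "scal_part (star u) = cnj (scal_part u)"
  for u :: "'a unitization"
  by (simp_all add: scaleC_unitization_def star_unitization_def)

lemma onorm_left_mult_mult:
  "onorm (left_mult (u * v)) \<le> onorm (left_mult u) * onorm (left_mult v)" for u :: "'a unitization"
  unfolding left_mult_mult by (intro onorm_compose bounded_linear_left_mult)

lemma onorm_left_mult_nonneg: "0 \<le> onorm (left_mult (u::'a unitization))"
  by (rule onorm_pos_le[OF bounded_linear_left_mult])

lemma onorm_left_mult_square:
  "(onorm (left_mult u))\<^sup>2 \<le> onorm (left_mult (star u * u))" for u :: "'a unitization"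
proof -
  let ?K = "onorm (left_mult (star u * u))"
  have K: "0 \<le> ?K" by (rule onorm_left_mult_nonneg)
  have "norm (left_mult u x) \<le> sqrt ?K * norm x" for x
  proof -
    have "star (left_mult u x) * left_mult u x = star x * left_mult (star u * u) x"
      by (simp add: left_mult_def algebra_simps star_add star_mult star_scaleC scaleC_add_right
          mult_scaleC_left mult_scaleC_right scaleC_scaleC)
    then have "(norm (left_mult u x))\<^sup>2 = norm (star x * left_mult (star u * u) x)"
      using cstar_identity[of "left_mult u x"] by simp
    also have "\<dots> \<le> norm x * norm (left_mult (star u * u) x)"
      using norm_mult_ineq[of "star x"] by simp
    also have "\<dots> \<le> norm x * (?K * norm x)"
      by (intro mult_left_mono norm_left_mult_le) simp
    also have "\<dots> = (sqrt ?K * norm x)\<^sup>2"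
      using K by (simp add: power_mult_distrib power2_eq_square)
    finally show ?thesis by (rule power2_le_imp_le) (simp add: K)
  qed
  then have "onorm (left_mult u) \<le> sqrt ?K"
    by (intro onorm_bound) (auto simp: K)
  then have "(onorm (left_mult u))\<^sup>2 \<le> (sqrt ?K)\<^sup>2"
    by (intro power_mono onorm_left_mult_nonneg)
  then show ?thesis using K by simp
qed

lemma onorm_left_mult_star: "onorm (left_mult (star u)) = onorm (left_mult u)" for u :: "'a unitization"
proof -
  have le: "onorm (left_mult v) \<le> onorm (left_mult (star v))" for v :: "'a unitization"
  proof (cases "onorm (left_mult v) = 0")
    case False
    have "onorm (left_mult v) * onorm (left_mult v) \<le> onorm (left_mult (star v)) * onorm (left_mult v)"
      using onorm_left_mult_square[of v] onorm_left_mult_mult[of "star v" v]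
      by (simp add: power2_eq_square)
    then show ?thesis using False onorm_left_mult_nonneg[of v] by simp
  qed (simp add: onorm_left_mult_nonneg)
  have ss: "star (star u) = u"
    by (rule unitization.expand) (simp add: star_star)
  from le[of u] le[of "star u"] show ?thesis by (simp add: ss)
qed

instance
proof
  fix u v :: "'a unitization" and c d :: complex and r :: real
  show "c *\<^sub>C (u + v) = c *\<^sub>C u + c *\<^sub>C v" "(c + d) *\<^sub>C u = c *\<^sub>C u + d *\<^sub>C u"
    "c *\<^sub>C (d *\<^sub>C u) = (c * d) *\<^sub>C u" "r *\<^sub>R u = complex_of_real r *\<^sub>C u"
    "(c *\<^sub>C u) * v = c *\<^sub>C (u * v)" "u * (c *\<^sub>C v) = c *\<^sub>C (u * v)"
    "star (star u) = u" "star (u + v) = star u + star v" "star (c *\<^sub>C u) = cnj c *\<^sub>C star u"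
    "star (u * v) = star v * star u"
    by (rule unitization.expand, simp add: algebra_simps scaleC_add_right scaleC_add_left
        scaleC_scaleC scaleR_scaleC scaleR_conv_of_real[where 'a = complex] mult_scaleC_left mult_scaleC_right
        star_star star_add star_scaleC star_mult)+
  show mult: "norm (u * v) \<le> norm u * norm v" for u v :: "'a unitization"
  proof -
    have "onorm (left_mult (u * v)) \<le> norm u * norm v"
      by (rule order_trans[OF onorm_left_mult_mult], rule mult_mono)
        (auto simp: norm_unitization_def onorm_left_mult_nonneg le_max_iff_disj)
    moreover have "cmod (scal_part (u * v)) \<le> norm u * norm v"
      unfolding unitization_parts norm_mult by (intro mult_mono scal_part_le_norm) auto
    ultimately show ?thesis by (subst norm_unitization_def) simp
  qed
  show norm_1: "norm (1::'a unitization) = 1"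
    using onorm_id_le[where 'a = 'a] by (simp add: norm_unitization_def left_mult_def[abs_def])
  have "left_mult (c *\<^sub>C u) = (\<lambda>x. c *\<^sub>C left_mult u x)" for c and u :: "'a unitization"
    by (rule ext) (simp add: left_mult_def scaleC_add_right scaleC_scaleC mult_scaleC_left)
  then have sc_le: "onorm (left_mult (c *\<^sub>C u)) \<le> cmod c * onorm (left_mult u)" for c and u :: "'a unitization"
    by (intro onorm_bound) (auto simp: norm_scaleC onorm_left_mult_nonneg mult.assoc
        intro!: mult_left_mono norm_left_mult_le)
  have sc: "onorm (left_mult (c *\<^sub>C u)) = cmod c * onorm (left_mult u)" for c and u :: "'a unitization"
  proof (cases "c = 0")
    case True
    then show ?thesis using sc_le[of c u] onorm_left_mult_nonneg[of "c *\<^sub>C u"] by simp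
  next
    case False
    have "inverse c *\<^sub>C c *\<^sub>C u = u"
      using False by (intro unitization.expand) (simp add: scaleC_scaleC)
    then have "onorm (left_mult u) \<le> cmod (inverse c) * onorm (left_mult (c *\<^sub>C u))"
      using sc_le[of "inverse c" "c *\<^sub>C u"] by simp
    then have "cmod c * onorm (left_mult u) \<le> onorm (left_mult (c *\<^sub>C u))"
      using False by (simp add: norm_inverse) (simp add: field_simps norm_divide)
    with sc_le[of c u] show ?thesis by simp
  qed
  show norm_C: "norm (c *\<^sub>C u) = cmod c * norm u" for c and u :: "'a unitization"
    unfolding norm_unitization_def sc by (simp add: norm_mult max_mult_distrib_left)
  have on: "onorm (left_mult (star u * u)) = (onorm (left_mult u))\<^sup>2"
    using onorm_left_mult_mult[of "star u" u] onorm_left_mult_square[of u]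
    by (simp add: onorm_left_mult_star power2_eq_square)
  have max_square: "max (x\<^sup>2) (y\<^sup>2) = (max x y)\<^sup>2" if "0 \<le> x" "0 \<le> y" for x y :: real
    using that power_mono[of x y 2] power_mono[of y x 2] unfolding max_def by force
  have "cmod (scal_part (star u * u)) = (cmod (scal_part u))\<^sup>2"
    by (simp add: norm_mult power2_eq_square)
  then show "norm (star u * u) = (norm u)\<^sup>2"
    unfolding norm_unitization_def on
    by (simp only: max_square onorm_left_mult_nonneg norm_ge_zero)
  fix X :: "nat \<Rightarrow> 'a unitization"
  assume X: "Cauchy X"
  have dist_scal: "dist (scal_part u) (scal_part v) \<le> dist u v" for u v :: "'a unitization"
    using scal_part_le_norm[of "u - v"] by (simp add: dist_norm)
  have "norm (alg_part u) \<le> 2 * norm u" for u :: "'a unitization"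
  proof -
    have "Unitization (alg_part u) 0 = u - scal_part u *\<^sub>C 1"
      by (rule unitization.expand) simp
    then have "norm (alg_part u) \<le> norm u + norm (scal_part u *\<^sub>C (1::'a unitization))"
      by (metis norm_triangle_ineq4 norm_unitization_embed)
    also have "norm (scal_part u *\<^sub>C (1::'a unitization)) \<le> norm u"
      by (simp add: norm_C norm_1 scal_part_le_norm)
    finally show ?thesis by simp
  qed
  from this[of "u - v" for u v]
  have dist_alg: "dist (alg_part u) (alg_part v) \<le> 2 * dist u v" for u v :: "'a unitization"
    by (simp add: dist_norm)
  have "Cauchy (\<lambda>n. scal_part (X n))"
    unfolding Cauchy_def by (meson X[unfolded Cauchy_def] dist_scal le_less_trans)
  then obtain c where c: "(\<lambda>n. scal_part (X n)) \<longlonglongrightarrow> c"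
    using Cauchy_convergent convergent_def by blast
  have "Cauchy (\<lambda>n. alg_part (X n))"
  proof (rule metric_CauchyI)
    fix e :: real assume "0 < e"
    then obtain M where "\<forall>m\<ge>M. \<forall>n\<ge>M. dist (X m) (X n) < e / 2"
      using metric_CauchyD[OF X, of "e / 2"] by auto
    then have "dist (alg_part (X m)) (alg_part (X n)) < e" if "m \<ge> M" "n \<ge> M" for m n
      using dist_alg[of "X m" "X n"] that by fastforce
    then show "\<exists>M. \<forall>m\<ge>M. \<forall>n\<ge>M. dist (alg_part (X m)) (alg_part (X n)) < e" by blast
  qed
  then obtain a where a: "(\<lambda>n. alg_part (X n)) \<longlonglongrightarrow> a"
    using Cauchy_convergent convergent_def by blast
  have bound: "norm u \<le> norm (alg_part u) + cmod (scal_part u)" for u :: "'a unitization"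
  proof -
    have "norm (left_mult u x) \<le> (norm (alg_part u) + cmod (scal_part u)) * norm x" for x
      unfolding left_mult_def distrib_right
      by (rule norm_triangle_mono) (simp_all add: norm_mult_ineq norm_scaleC)
    then have "onorm (left_mult u) \<le> norm (alg_part u) + cmod (scal_part u)"
      by (intro onorm_bound) auto
    then show ?thesis by (simp add: norm_unitization_def)
  qed
  have "(\<lambda>n. norm (alg_part (X n) - a) + cmod (scal_part (X n) - c)) \<longlonglongrightarrow> 0 + 0"
    using a c by (intro tendsto_add) (simp_all add: tendsto_norm_zero_iff LIM_zero_iff)
  then have lim: "(\<lambda>n. norm (alg_part (X n) - a) + cmod (scal_part (X n) - c)) \<longlonglongrightarrow> 0"
    by simp
  have "(\<lambda>n. dist (X n) (Unitization a c)) \<longlonglongrightarrow> 0"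
    by (rule Lim_null_comparison[OF _ lim], rule always_eventually)
      (use bound[of "X n - Unitization a c" for n] in \<open>simp add: dist_norm\<close>)
  then have "X \<longlonglongrightarrow> Unitization a c" by (rule iffD2[OF tendsto_dist_iff])
  then show "convergent X" by (rule convergentI)
qed

end

lemma norm_unitization_nonunital:
  assumes "\<not> unital TYPE('a::cstar_algebra)"
  shows "norm (u::'a unitization) = onorm (left_mult u)"
proof (rule ccontr)
  assume "norm u \<noteq> onorm (left_mult u)"
  then have lt: "onorm (left_mult u) < cmod (scal_part u)"
    by (auto simp: norm_unitization_def max_def split: if_splits)
  define c where "c = scal_part u"
  define v where "v = inverse c *\<^sub>C u"
  define r where "r = onorm (left_mult u) / cmod c"
  define p where "p = - alg_part v"
  have c0: "c \<noteq> 0" using lt onorm_left_mult_nonneg[of u] by (auto simp: c_def)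
  have r: "0 \<le> r" "r < 1"
    using lt onorm_left_mult_nonneg[of u] c0 by (auto simp: r_def c_def)
  have sv: "scal_part v = 1" using c0 by (simp add: v_def c_def)
  have lv: "left_mult v x = x - p * x" for x
    by (simp add: left_mult_def sv p_def)
  have "left_mult v x = inverse c *\<^sub>C left_mult u x" for x
    by (simp add: left_mult_def v_def scaleC_add_right scaleC_scaleC mult_scaleC_left)
  then have eq: "x - p * x = inverse c *\<^sub>C left_mult u x" for x
    using lv by metis
  have contr: "norm (x - p * x) \<le> r * norm x" for x
    using norm_left_mult_le[of u x] c0 unfolding eq
    by (simp add: norm_scaleC norm_inverse r_def) (simp add: field_simps norm_divide)
  have "dist (x - p * x + p) (y - p * y + p) \<le> r * dist x y" for x y
    using contr[of "x - y"] by (simp add: dist_norm algebra_simps)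
  then obtain e where "e - p * e + p = e"
    using banach_fix_type[OF r, of "\<lambda>x. x - p * x + p"] by blast
  then have e: "p * e = p" by (simp add: algebra_simps)
  have left: "e * b = b" for b
  proof (rule ccontr)
    assume "e * b \<noteq> b"
    then have pos: "0 < norm (e * b - b)" by simp
    have "p * (e * b - b) = 0"
      by (simp add: right_diff_distrib mult.assoc[symmetric] e)
    then have "norm (e * b - b) \<le> r * norm (e * b - b)"
      using contr[of "e * b - b"] by simp
    then show False using mult_strict_right_mono[OF r(2) pos] by simp
  qed
  have right: "b * star e = b" for b
    using left[of "star b"] by (metis star_mult star_star)
  have "star e = e" using left[of "star e"] right[of e] by simp
  then have "\<forall>a. e * a = a \<and> a * e = a" using left right by metis
  then show False using assms unfolding unital_def by blast
qed

section \<open>Hilbert modules over unital C*-algebras\<close>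

text \<open>
  Modules are given by explicit operations on an explicit carrier set, since the theorem
  quantifies over them.
\<close>

record ('b, 'm) hmod =
  hcarrier :: "'m set"
  hzero :: 'm
  hadd :: "'m \<Rightarrow> 'm \<Rightarrow> 'm"
  hact :: "'m \<Rightarrow> 'b \<Rightarrow> 'm"
  hinner :: "'m \<Rightarrow> 'm \<Rightarrow> 'b"

definition hnorm :: "('b::unital_cstar_algebra, 'm) hmod \<Rightarrow> 'm \<Rightarrow> real" where
  "hnorm M x = sqrt (norm (hinner M x x))"

definition hdiff :: "('b::unital_cstar_algebra, 'm) hmod \<Rightarrow> 'm \<Rightarrow> 'm \<Rightarrow> 'm" where
  "hdiff M x y = hadd M x (hact M y (- 1))"

text \<open>
  Right Hilbert modules; the inner product is linear in its second argument. Multiplication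
  by a complex number \<open>c\<close> is the action of \<open>c *\<^sub>C 1\<close>.
\<close>

locale hilbert_module =
  fixes M :: "('b::unital_cstar_algebra, 'm) hmod"
  assumes zero_closed: "hzero M \<in> hcarrier M"
    and add_closed: "x \<in> hcarrier M \<Longrightarrow> y \<in> hcarrier M \<Longrightarrow> hadd M x y \<in> hcarrier M"
    and act_closed: "x \<in> hcarrier M \<Longrightarrow> hact M x b \<in> hcarrier M"
    and add_assoc: "x \<in> hcarrier M \<Longrightarrow> y \<in> hcarrier M \<Longrightarrow> z \<in> hcarrier M \<Longrightarrow>
      hadd M (hadd M x y) z = hadd M x (hadd M y z)"
    and add_commute: "x \<in> hcarrier M \<Longrightarrow> y \<in> hcarrier M \<Longrightarrow> hadd M x y = hadd M y x"
    and add_zero: "x \<in> hcarrier M \<Longrightarrow> hadd M (hzero M) x = x"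
    and add_inverse: "x \<in> hcarrier M \<Longrightarrow> \<exists>y\<in>hcarrier M. hadd M x y = hzero M"
    and act_add: "x \<in> hcarrier M \<Longrightarrow> y \<in> hcarrier M \<Longrightarrow>
      hact M (hadd M x y) b = hadd M (hact M x b) (hact M y b)"
    and act_add_scalar: "x \<in> hcarrier M \<Longrightarrow> hact M x (b + b') = hadd M (hact M x b) (hact M x b')"
    and act_mult: "x \<in> hcarrier M \<Longrightarrow> hact M x (b * b') = hact M (hact M x b) b'"
    and act_one: "x \<in> hcarrier M \<Longrightarrow> hact M x 1 = x"
    and inner_add: "x \<in> hcarrier M \<Longrightarrow> y \<in> hcarrier M \<Longrightarrow> z \<in> hcarrier M \<Longrightarrow>
      hinner M x (hadd M y z) = hinner M x y + hinner M x z"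
    and inner_act: "x \<in> hcarrier M \<Longrightarrow> y \<in> hcarrier M \<Longrightarrow>
      hinner M x (hact M y b) = hinner M x y * b"
    and inner_star: "x \<in> hcarrier M \<Longrightarrow> y \<in> hcarrier M \<Longrightarrow> hinner M y x = star (hinner M x y)"
    and inner_positive: "x \<in> hcarrier M \<Longrightarrow> cstar_positive (hinner M x x)"
    and inner_definite: "x \<in> hcarrier M \<Longrightarrow> hinner M x x = 0 \<Longrightarrow> x = hzero M"
    and complete: "(\<And>n. X n \<in> hcarrier M) \<Longrightarrow>
      (\<And>e. 0 < e \<Longrightarrow> \<exists>n0. \<forall>m\<ge>n0. \<forall>n\<ge>n0. hnorm M (hdiff M (X m) (X n)) < e) \<Longrightarrow>
      \<exists>x\<in>hcarrier M. (\<lambda>n. hnorm M (hdiff M (X n) x)) \<longlonglongrightarrow> 0"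

definition hmod_sum :: "('b::unital_cstar_algebra, 'm) hmod \<Rightarrow> ('b, 'n) hmod \<Rightarrow> ('b, 'm \<times> 'n) hmod" where
  "hmod_sum M N = \<lparr>
     hcarrier = hcarrier M \<times> hcarrier N,
     hzero = (hzero M, hzero N),
     hadd = (\<lambda>x y. (hadd M (fst x) (fst y), hadd N (snd x) (snd y))),
     hact = (\<lambda>x b. (hact M (fst x) b, hact N (snd x) b)),
     hinner = (\<lambda>x y. hinner M (fst x) (fst y) + hinner N (snd x) (snd y))\<rparr>"

text \<open>
  A family indexed by \<open>\<Lambda>\<close> is encoded as a function that vanishes outside \<open>\<Lambda>\<close>.
\<close>

definition standard_module :: "'l set \<Rightarrow> ('b::unital_cstar_algebra, 'l \<Rightarrow> 'b) hmod" where
  "standard_module \<Lambda> = \<lparr>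
     hcarrier = {x. (\<forall>l. l \<notin> \<Lambda> \<longrightarrow> x l = 0) \<and> (\<lambda>l. star (x l) * x l) summable_on \<Lambda>},
     hzero = (\<lambda>_. 0),
     hadd = (\<lambda>x y l. x l + y l),
     hact = (\<lambda>x b l. x l * b),
     hinner = (\<lambda>x y. infsum (\<lambda>l. star (x l) * y l) \<Lambda>)\<rparr>"

definition hmod_iso :: "('b::unital_cstar_algebra, 'm) hmod \<Rightarrow> ('b, 'n) hmod \<Rightarrow> ('m \<Rightarrow> 'n) \<Rightarrow> bool" where
  "hmod_iso M N f \<longleftrightarrow>
     bij_betw f (hcarrier M) (hcarrier N) \<and>
     (\<forall>x\<in>hcarrier M. \<forall>y\<in>hcarrier M. f (hadd M x y) = hadd N (f x) (f y)) \<and>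
     (\<forall>x\<in>hcarrier M. \<forall>b. f (hact M x b) = hact N (f x) b) \<and>
     (\<forall>x\<in>hcarrier M. \<forall>y\<in>hcarrier M. hinner N (f x) (f y) = hinner M x y)"

definition hmod_isomorphic :: "('b::unital_cstar_algebra, 'm) hmod \<Rightarrow> ('b, 'n) hmod \<Rightarrow> bool" where
  "hmod_isomorphic M N \<longleftrightarrow> (\<exists>f. hmod_iso M N f)"

text \<open>
  A C*-algebra as a Hilbert module over its unitalization: \<open>a (b + c 1) = a b + c a\<close> and
  \<open>\<langle>a, b\<rangle> = a* b\<close>.
\<close>

definition algebra_module :: "('a::cstar_algebra unitization, 'a) hmod" where
  "algebra_module = \<lparr>
     hcarrier = UNIV,
     hzero = 0,
     hadd = (+),
     hact = (\<lambda>a u. a * alg_part u + scal_part u *\<^sub>C a),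
     hinner = (\<lambda>a b. Unitization (star a * b) 0)\<rparr>"

end

theory Submission
  imports Defs
begin

text \<open>
  Suppose \<open>S : \<A> \<rightarrow> \<Oplus>\<^sub>\<Lambda> \<A>\<^sup>\<bullet>\<close> is the isometric inclusion of an orthogonal summand, where
  \<open>\<A>\<^sup>\<bullet>\<close> is the unitalization. Its adjoint sends the \<open>\<lambda>\<close>-th basis vector to some \<open>g\<^sub>\<lambda> \<in> \<A>\<close>,
  and then \<open>S a\<close> has the components \<open>g\<^sub>\<lambda>* a\<close>. Since \<open>S\<close> preserves inner products,
  \<open>\<Sum>\<^sub>\<lambda> (g\<^sub>\<lambda>* a)* (g\<^sub>\<lambda>* a) = a* a\<close> in norm for every \<open>a \<in> \<A>\<close>: the \<open>g\<^sub>\<lambda>\<close> form a frame of \<open>\<A>\<close>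
  (\<open>direct_summand_has_frame\<close>). That no such frame exists
  (\<open>no_frame_if_locally_unital\<close>) is a gliding hump argument.

  Because \<open>\<A>\<close> has local units but no unit, for any finite \<open>B \<subseteq> \<A>\<close> some
  self-adjoint \<open>x\<close> of norm \<open>1\<close> annihilates \<open>B\<close>, in the sense that \<open>b* x = 0\<close> for all \<open>b \<in> B\<close>.
  Apply this again and again, each time annihilating the previous \<open>x\<close>'s and the frame
  elements used so far; as the frame identity at \<open>x\<close> involves only frame elements that \<open>x\<close> does not annihilate, this yields self-adjoint unit vectors
  \<open>x\<^sub>n\<close> with \<open>x\<^sub>m x\<^sub>n = 0\<close> for \<open>m \<noteq> n\<close> and disjoint finite sets \<open>G\<^sub>n \<subseteq> \<Lambda>\<close> such that the partial
  frame sum of \<open>x\<^sub>n\<close> over \<open>G\<^sub>n\<close> has norm at least \<open>1/2\<close>. By local unitality of \<open>\<A>\<close>, and because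
  \<open>\<A>\<close> is complete, one \<open>h\<close> satisfies \<open>h x\<^sub>n = x\<^sub>n\<close> for all \<open>n\<close>: a local unit of
  \<open>\<Sum>\<^sub>n 2\<^sup>-\<^sup>n x\<^sub>n\<close> does, by orthogonality. Hence the partial frame sums of \<open>h\<close> over
  all the disjoint sets \<open>G\<^sub>n\<close> have norm at least \<open>1/2\<close>, so that the frame sum of \<open>h\<close> diverges.
\<close>

section \<open>Annihilators and local units\<close>

lemma star_minus: "star (- x) = - star (x::'a::cstar_algebra)"
  using star_add[of x "- x"] by (simp add: eq_neg_iff_add_eq_0 add.commute)

lemma star_diff: "star (x - y) = star x - star (y::'a::cstar_algebra)"
  using star_add[of x "- y"] by (simp add: star_minus)

lemma star_scaleR: "star (r *\<^sub>R x) = r *\<^sub>R star (x::'a::cstar_algebra)"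
  by (simp add: scaleR_scaleC star_scaleC)

lemma mult_star_eq_0_iff [simp]: "x * star x = 0 \<longleftrightarrow> x = (0::'a::cstar_algebra)"
  using cstar_identity[of "star x"] by (auto simp: star_star)

text \<open>
  If \<open>h\<close> is a local unit of \<open>b\<close> and \<open>k\<close> one of \<open>(1 - h) c\<close>, then \<open>1 - u = (1 - k)(1 - h)\<close> defines
  an element \<open>u\<close> that fixes \<open>b\<close> and \<open>c\<close> from the left. It need not be self-adjoint, but a local
  unit of \<open>u\<close> fixes everything that \<open>u\<close> fixes.
\<close>

lemma finite_common_left_unit:
  fixes B :: "'a::cstar_algebra set"
  assumes lu: "locally_unital TYPE('a)" and "finite B"
  shows "\<exists>h. star h = h \<and> (\<forall>b\<in>B. h * b = b)"
  using \<open>finite B\<close>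
proof (induction B rule: finite_induct)
  case empty
  show ?case by (intro exI[of _ 0]) simp
next
  case (insert c B)
  then obtain h where h: "\<And>b. b \<in> B \<Longrightarrow> h * b = b" by blast
  obtain k where k: "local_unit k (c - h * c)"
    using lu unfolding locally_unital_def by blast
  define u where "u = h + k - k * h"
  obtain v where v: "local_unit v u"
    using lu unfolding locally_unital_def by blast
  have uB: "u * b = b" if "b \<in> B" for b
    using h[OF that] by (simp add: u_def algebra_simps mult.assoc)
  have uc: "u * c = c"
    using k by (simp add: u_def local_unit_def algebra_simps mult.assoc)
  have "v * b = b" if "u * b = b" for b
    using v that unfolding local_unit_def by (metis mult.assoc)
  with uB uc v show ?case
    unfolding local_unit_def by (intro exI[of _ v]) auto
qed

text \<open>
  With \<open>h\<close> fixing \<open>B\<close> from the left, \<open>(1 - h) y\<close> is annihilated by \<open>b*\<close> for every \<open>b \<in> B\<close>, and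
  it is nonzero for some \<open>y\<close> because \<open>h\<close> is not a unit. If \<open>z\<close> is such a vector, so is \<open>z z*\<close>,
  which is moreover self-adjoint.
\<close>

lemma self_adjoint_annihilator:
  fixes B :: "'a::cstar_algebra set"
  assumes nu: "\<not> unital TYPE('a)" and lu: "locally_unital TYPE('a)" and "finite B"
  shows "\<exists>x. star x = x \<and> norm x = 1 \<and> (\<forall>b\<in>B. star b * x = 0)"
proof -
  obtain h where h: "star h = h" "\<And>b. b \<in> B \<Longrightarrow> h * b = b"
    using finite_common_left_unit[OF lu \<open>finite B\<close>] by blast
  have "\<exists>y. h * y \<noteq> y"
  proof (rule ccontr)
    assume "\<nexists>y. h * y \<noteq> y"
    then have l: "h * y = y" for y by blast
    then have "y * h = y" for y
      using l[of "star y"] h(1) by (metis star_mult star_star)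
    with l nu show False unfolding unital_def by blast
  qed
  then obtain y where y: "h * y \<noteq> y" by blast
  define z where "z = y - h * y"
  define x where "x = (1 / norm (z * star z)) *\<^sub>R (z * star z)"
  have zz: "z * star z \<noteq> 0"
    using y by (simp add: z_def)
  have "star b * z = 0" if "b \<in> B" for b
  proof -
    have "star b * h = star b"
      using h(2)[OF that] h(1) by (metis star_mult)
    then show ?thesis
      by (simp add: z_def right_diff_distrib flip: mult.assoc)
  qed
  then have "\<forall>b\<in>B. star b * x = 0"
    by (simp add: x_def flip: mult.assoc)
  moreover have "star x = x"
    by (simp add: x_def star_scaleR star_mult star_star)
  moreover have "norm x = 1"
    using zz by (simp add: x_def)
  ultimately show ?thesis by blast
qed

text \<open>
  For \<open>a = \<Sum>\<^sub>n 2\<^sup>-\<^sup>n x\<^sub>n\<close> orthogonality gives \<open>a x\<^sub>m = 2\<^sup>-\<^sup>m x\<^sub>m\<^sup>2\<close>. So a local unit \<open>h\<close> of \<open>a\<close> satisfies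
  \<open>(1 - h) x\<^sub>m\<^sup>2 = 0\<close>, and then \<open>(1 - h) x\<^sub>m\<close> vanishes because \<open>((1 - h) x\<^sub>m) ((1 - h) x\<^sub>m)*\<close> does.
\<close>

lemma orthogonal_sequence_common_local_unit:
  fixes x :: "nat \<Rightarrow> 'a::cstar_algebra"
  assumes lu: "locally_unital TYPE('a)"
    and sa: "\<And>n. star (x n) = x n" and bdd: "\<And>n. norm (x n) \<le> 1"
    and orth: "\<And>m n. m \<noteq> n \<Longrightarrow> x m * x n = 0"
  shows "\<exists>h. star h = h \<and> (\<forall>n. h * x n = x n)"
proof -
  define a where "a = (\<Sum>n. (1/2)^n *\<^sub>R x n)"
  have "summable (\<lambda>n. norm ((1/2)^n *\<^sub>R x n))"
  proof (rule summable_comparison_test'[where N = 0])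
    show "summable (\<lambda>n. (1/2::real)^n)" by (rule summable_geometric) simp
    show "norm (norm ((1/2)^n *\<^sub>R x n)) \<le> (1/2)^n" for n
      using mult_left_mono[OF bdd[of n], of "(1/2)^n"] by simp
  qed
  then have "(\<lambda>n. (1/2)^n *\<^sub>R x n) sums a"
    unfolding a_def by (rule summable_sums[OF summable_norm_cancel])
  then have 1: "(\<lambda>n. (1/2)^n *\<^sub>R x n * x m) sums (a * x m)" for m
    by (rule sums_mult2)
  have ax: "a * x m = (1/2)^m *\<^sub>R (x m * x m)" for m
  proof (rule sums_unique2[OF 1])
    have "(\<lambda>n. (1/2)^n *\<^sub>R x n * x m) = (\<lambda>n. if n = m then (1/2)^n *\<^sub>R (x n * x m) else 0)"
      using orth by auto
    then show "(\<lambda>n. (1/2)^n *\<^sub>R x n * x m) sums ((1/2)^m *\<^sub>R (x m * x m))"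
      using sums_single[of m "\<lambda>n. (1/2)^n *\<^sub>R (x n * x m)"] by simp
  qed
  obtain h where h: "star h = h" "h * a = a"
    using lu unfolding locally_unital_def local_unit_def by blast
  have "h * x m = x m" for m
  proof -
    have "h * (a * x m) = a * x m"
      using h(2) by (simp flip: mult.assoc)
    then have sq: "h * (x m * x m) = x m * x m"
      by (simp add: ax)
    have "(x m - h * x m) * star (x m - h * x m)
        = (x m * x m - h * (x m * x m)) - (x m * x m - h * (x m * x m)) * h"
      by (simp add: star_diff star_mult sa h(1) algebra_simps mult.assoc)
    also have "\<dots> = 0" by (simp add: sq)
    finally show ?thesis by simp
  qed
  with h(1) show ?thesis by blast
qed

section \<open>Frames\<close>

lemma has_sum_finite_approx:
  fixes f :: "'l \<Rightarrow> 'b::real_normed_vector"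
  assumes "(f has_sum s) A" and "0 < e"
  shows "\<exists>F. finite F \<and> F \<subseteq> A \<and> (\<forall>G. finite G \<and> F \<subseteq> G \<and> G \<subseteq> A \<longrightarrow> norm (sum f G - s) < e)"
  using tendstoD[OF assms(1)[unfolded has_sum_def] assms(2)]
  by (auto simp: eventually_finite_subsets_at_top dist_norm)

text \<open>
  A pairwise disjoint sequence of sets leaves every finite set behind, so that the Cauchy
  criterion makes sums over its members small.
\<close>

lemma summable_on_disjoint_finite_sums_small:
  fixes f :: "'l \<Rightarrow> 'b::real_normed_vector"
  assumes "f summable_on A" and "0 < e"
    and G: "\<And>n::nat. finite (G n)" "\<And>n. G n \<subseteq> A"
    and disj: "\<And>m n. m < n \<Longrightarrow> G m \<inter> G n = {}"
  shows "\<exists>n. norm (sum f (G n)) < e"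
proof -
  obtain s where "(f has_sum s) A" using assms(1) by (auto simp: summable_on_def)
  then obtain F where F: "finite F" "F \<subseteq> A"
    "\<And>H. finite H \<Longrightarrow> F \<subseteq> H \<Longrightarrow> H \<subseteq> A \<Longrightarrow> norm (sum f H - s) < e / 2"
    using has_sum_finite_approx[of f A s "e / 2"] \<open>0 < e\<close> by auto
  have "\<exists>n. F \<inter> G n = {}"
  proof (rule ccontr)
    assume "\<nexists>n. F \<inter> G n = {}"
    then have "\<forall>n. \<exists>l. l \<in> F \<inter> G n" by blast
    then obtain p where p: "\<And>n. p n \<in> F \<inter> G n" by metis
    have "inj p"
    proof (rule linorder_injI)
      show "p m \<noteq> p n" if "m < n" for m n
        using p[of m] p[of n] disj[OF that] by auto
    qed
    moreover have "range p \<subseteq> F" using p by blast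
    ultimately show False
      using F(1) by (meson finite_subset range_inj_infinite)
  qed
  then obtain n where n: "F \<inter> G n = {}" by blast
  have "sum f (F \<union> G n) = sum f F + sum f (G n)"
    using F(1) G(1) n by (rule sum.union_disjoint)
  then have "sum f (G n) = (sum f (F \<union> G n) - s) - (sum f F - s)" by simp
  then have "norm (sum f (G n)) \<le> norm (sum f (F \<union> G n) - s) + norm (sum f F - s)"
    by (metis norm_triangle_ineq4)
  also have "\<dots> < e / 2 + e / 2"
    using F G by (intro add_strict_mono F(3)) auto
  finally show ?thesis by (intro exI[of _ n]) simp
qed

lemma no_frame_if_locally_unital:
  fixes g :: "'l \<Rightarrow> 'a::cstar_algebra" and \<Lambda> :: "'l set"
  assumes nu: "\<not> unital TYPE('a)" and lu: "locally_unital TYPE('a)"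
    and frame: "\<And>a. ((\<lambda>l. star (star (g l) * a) * (star (g l) * a)) has_sum star a * a) \<Lambda>"
  shows False
proof -
  define \<phi> where "\<phi> a l = star (star (g l) * a) * (star (g l) * a)" for a l
  have step: "\<exists>x G. star x = x \<and> norm x = 1 \<and> (\<forall>b\<in>B. star b * x = 0) \<and> finite G \<and> G \<subseteq> \<Lambda> \<and>
      (\<forall>l\<in>G. star (g l) * x \<noteq> 0) \<and> 1/2 \<le> norm (sum (\<phi> x) G)" if B: "finite B" for B
  proof -
    obtain x where x: "star x = x" "norm x = 1" "\<forall>b\<in>B. star b * x = 0"
      using self_adjoint_annihilator[OF nu lu B] by blast
    obtain F where F: "finite F" "F \<subseteq> \<Lambda>" "norm (sum (\<phi> x) F - star x * x) < 1/2"
      using has_sum_finite_approx[OF frame[of x], of "1/2"] unfolding \<phi>_def by auto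
    define G where "G = {l \<in> F. star (g l) * x \<noteq> 0}"
    have "sum (\<phi> x) G = sum (\<phi> x) F"
      by (rule sum.mono_neutral_left) (auto simp: G_def F(1) \<phi>_def)
    moreover have "1 \<le> norm (sum (\<phi> x) F) + norm (sum (\<phi> x) F - star x * x)"
      using norm_triangle_ineq4[of "sum (\<phi> x) F" "sum (\<phi> x) F - star x * x"] x(2)
      by (simp add: cstar_identity)
    ultimately have "1/2 \<le> norm (sum (\<phi> x) G)" using F(3) by simp
    then show ?thesis
      using x F(1,2) by (intro exI[of _ x] exI[of _ G]) (auto simp: G_def)
  qed

  \<comment> \<open>Stage \<open>n\<close> of the construction carries, besides \<open>x\<^sub>n\<close> and \<open>G\<^sub>n\<close>, the finite set \<open>B\<^sub>n\<close> of
    everything that all later vectors have to annihilate.\<close>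
  define P where "P = (\<lambda>(B, x, G). finite B \<and> x \<in> B \<and> g ` G \<subseteq> B \<and> star x = x \<and> norm x = 1 \<and>
      finite G \<and> G \<subseteq> \<Lambda> \<and> (\<forall>l\<in>G. star (g l) * x \<noteq> 0) \<and> 1/2 \<le> norm (sum (\<phi> x) G))"
  define Q where "Q = (\<lambda>(B::'a set, x::'a, G::'l set) (B', x', G'::'l set).
      B \<subseteq> B' \<and> (\<forall>b\<in>B. star b * x' = 0))"
  have ext: "\<exists>B' x G. P (B', x, G) \<and> B \<subseteq> B' \<and> (\<forall>b\<in>B. star b * x = 0)" if B: "finite B" for B
  proof -
    obtain x G where "star x = x" "norm x = 1" "\<forall>b\<in>B. star b * x = 0" "finite G" "G \<subseteq> \<Lambda>"
      "\<forall>l\<in>G. star (g l) * x \<noteq> 0" "1/2 \<le> norm (sum (\<phi> x) G)"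
      using step[OF B] by blast
    then show ?thesis
      using B by (intro exI[of _ "insert x (B \<union> g ` G)"] exI[of _ x] exI[of _ G]) (auto simp: P_def)
  qed
  have "\<exists>s. \<forall>n. P (s n) \<and> Q (s n) (s (Suc n))"
  proof (rule dependent_nat_choice)
    show "\<exists>t. P t" using ext[of "{}"] by auto
  next
    fix t and n :: nat
    assume t: "P t"
    obtain B x G where Bt: "t = (B, x, G)" by (cases t)
    then have "finite B" using t by (simp add: P_def)
    then obtain B' x' G' where "P (B', x', G')" "B \<subseteq> B'" "\<forall>b\<in>B. star b * x' = 0"
      using ext by blast
    then show "\<exists>t'. P t' \<and> Q t t'"
      unfolding Bt Q_def by (intro exI[of _ "(B', x', G')"]) simp
  qed
  then obtain s where s: "\<And>n. P (s n)" "\<And>n. Q (s n) (s (Suc n))" by blast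
  define B where "B n = fst (s n)" for n
  define x where "x n = fst (snd (s n))" for n
  define G where "G n = snd (snd (s n))" for n
  have P: "P (B n, x n, G n)" for n
    using s(1)[of n] by (simp add: B_def x_def G_def)
  have Q: "B n \<subseteq> B (Suc n)" "\<forall>b\<in>B n. star b * x (Suc n) = 0" for n
    using s(2)[of n] by (auto simp: B_def x_def Q_def split: prod.splits)
  have annihilate: "star b * x n = 0" if mn: "m < n" and b: "b \<in> B m" for b m n
  proof -
    obtain k where k: "n = Suc k" "m \<le> k" using mn by (cases n) auto
    have "B m \<subseteq> B k" by (rule lift_Suc_mono_le[of B, OF Q(1) k(2)])
    with b Q(2)[of k] k(1) show ?thesis by auto
  qed
  have sa: "star (x n) = x n" and nrm: "norm (x n) = 1" and xB: "x n \<in> B n"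
    and G: "finite (G n)" "G n \<subseteq> \<Lambda>" and big: "1/2 \<le> norm (sum (\<phi> (x n)) (G n))" for n
    using P[of n] by (auto simp: P_def)
  have gB: "g l \<in> B n" and gx: "star (g l) * x n \<noteq> 0" if "l \<in> G n" for l n
    using P[of n] that by (auto simp: P_def)
  have lt: "x m * x n = 0" if "m < n" for m n
    using annihilate[OF that xB] by (simp add: sa)
  have orth: "x m * x n = 0" if "m \<noteq> n" for m n
  proof (cases "m < n")
    case False
    then have "star (x n * x m) = 0" using that lt[of n m] by simp
    then show ?thesis by (simp add: star_mult sa)
  qed (rule lt)
  have disj: "G m \<inter> G n = {}" if "m < n" for m n
    using annihilate[OF that gB] gx[of _ n] by blast
  obtain h where "star h = h \<and> (\<forall>n. h * x n = x n)"
    using orthogonal_sequence_common_local_unit[OF lu sa eq_refl[OF nrm] orth] by (rule exE)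
  then have h: "h * x n = x n" for n by (rule conjE) (erule spec)
  have "(\<phi> h) summable_on \<Lambda>"
    using frame[of h] unfolding summable_on_def \<phi>_def by blast
  then obtain n where n: "norm (sum (\<phi> h) (G n)) < 1/2"
    using summable_on_disjoint_finite_sums_small[of "\<phi> h" \<Lambda> "1/2" G] G disj by auto
  \<comment> \<open>Since \<open>x\<^sub>n = h x\<^sub>n\<close>, the frame sums of \<open>x\<^sub>n\<close> are those of \<open>h\<close> compressed by \<open>x\<^sub>n\<close>, hence
    no larger in norm.\<close>
  have "\<phi> (x n) l = x n * (\<phi> h l * x n)" for l
  proof -
    have "star (g l) * x n = (star (g l) * h) * x n"
      by (simp add: h mult.assoc)
    then have "\<phi> (x n) l = star ((star (g l) * h) * x n) * ((star (g l) * h) * x n)"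
      by (simp only: \<phi>_def)
    also have "\<dots> = x n * (\<phi> h l * x n)"
      unfolding \<phi>_def star_mult[of _ "x n"] sa by (simp only: mult.assoc)
    finally show ?thesis .
  qed
  then have "sum (\<phi> (x n)) (G n) = x n * (sum (\<phi> h) (G n) * x n)"
    by (simp add: sum_distrib_left sum_distrib_right)
  then have "norm (sum (\<phi> (x n)) (G n)) \<le> norm (sum (\<phi> h) (G n))"
    using norm_mult_ineq[of "x n" "sum (\<phi> h) (G n) * x n"]
      norm_mult_ineq[of "sum (\<phi> h) (G n)" "x n"] nrm[of n] by simp
  with big[of n] n show False by linarith
qed

section \<open>Direct summands of standard modules\<close>

lemma has_sum_unitization_embed:
  fixes f :: "'l \<Rightarrow> 'a::cstar_algebra"
  shows "((\<lambda>l. Unitization (f l) 0) has_sum Unitization s 0) A \<longleftrightarrow> (f has_sum s) A"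
proof -
  have sum: "(\<Sum>l\<in>F. Unitization (f l) 0) = Unitization (sum f F) 0" for F
    by (induction F rule: infinite_finite_induct)
      (simp_all add: zero_unitization_def plus_unitization_def)
  have "dist (Unitization a 0) (Unitization b 0) = dist a b" for a b :: 'a
    by (simp add: dist_norm minus_unitization_def)
  then show ?thesis
    unfolding has_sum_def sum by (subst (1 2) tendsto_dist_iff) simp
qed

lemma standard_basis_vector:
  fixes \<Lambda> :: "'l set"
  assumes "l \<in> \<Lambda>"
  defines "e \<equiv> (\<lambda>k. if k = l then 1 else 0) :: 'l \<Rightarrow> 'a::cstar_algebra unitization"
  shows "e \<in> hcarrier (standard_module \<Lambda>)" and "hinner (standard_module \<Lambda>) e y = y l"
proof -
  have star1: "star (1::'a unitization) = 1"
    by (rule unitization.expand) simp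
  have single: "((\<lambda>k. star (e k) * z k) has_sum z l) \<Lambda>" for z
  proof -
    have "((\<lambda>k. star (e k) * z k) has_sum z l) {l}"
      using has_sum_finite[of "{l}" "\<lambda>k. star (e k) * z k"] by (simp add: e_def star1)
    then show ?thesis
      by (rule has_sum_cong_neutral[THEN iffD1, rotated -1]) (use assms(1) in \<open>auto simp: e_def\<close>)
  qed
  show "e \<in> hcarrier (standard_module \<Lambda>)"
    using single[of e] assms(1) by (auto simp: standard_module_def summable_on_def e_def)
  show "hinner (standard_module \<Lambda>) e y = y l"
    using infsumI[OF single[of y]] by (simp add: standard_module_def)
qed

lemma (in hilbert_module) inner_zero_right:
  "x \<in> hcarrier M \<Longrightarrow> hinner M x (hzero M) = 0"
  using inner_add[of x "hzero M" "hzero M"] by (simp add: zero_closed add_zero)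

text \<open>
  The frame element \<open>g\<^sub>l\<close> is the \<open>\<A>\<close>-component of the preimage of the \<open>l\<close>-th basis vector
  \<open>e\<^sub>l\<close>; the \<open>l\<close>-th component of the image of \<open>(a, 0)\<close> is its inner product with \<open>e\<^sub>l\<close>, hence
  equal to \<open>\<langle>g\<^sub>l, a\<rangle>\<close>.
\<close>

lemma direct_summand_has_frame:
  fixes N :: "('a::cstar_algebra unitization, 'n) hmod" and \<Lambda> :: "'l set"
  assumes "hilbert_module N"
    and "hmod_isomorphic (hmod_sum (algebra_module :: ('a unitization, 'a) hmod) N)
      (standard_module \<Lambda>)"
  shows "\<exists>g :: 'l \<Rightarrow> 'a. \<forall>a.
    ((\<lambda>l. star (star (g l) * a) * (star (g l) * a)) has_sum star a * a) \<Lambda>"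
proof -
  interpret N: hilbert_module N by fact
  let ?M = "hmod_sum (algebra_module :: ('a unitization, 'a) hmod) N"
  let ?H = "standard_module \<Lambda> :: ('a unitization, 'l \<Rightarrow> 'a unitization) hmod"
  let ?e = "\<lambda>l k. if k = l then 1 else (0::'a unitization)"
  obtain f where f: "bij_betw f (hcarrier ?M) (hcarrier ?H)"
    and inner: "\<And>x y. x \<in> hcarrier ?M \<Longrightarrow> y \<in> hcarrier ?M \<Longrightarrow> hinner ?H (f x) (f y) = hinner ?M x y"
    using assms(2) unfolding hmod_isomorphic_def hmod_iso_def by blast
  define S where "S a = f (a, hzero N)" for a
  have a_in: "(a, hzero N) \<in> hcarrier ?M" for a
    by (simp add: hmod_sum_def algebra_module_def N.zero_closed)
  have inner_a: "hinner ?M (b, m) (a, hzero N) = Unitization (star b * a) 0"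
    if "m \<in> hcarrier N" for a b m
    using that by (simp add: hmod_sum_def algebra_module_def N.inner_zero_right)
  have "\<exists>b. \<forall>a. S a l = Unitization (star b * a) 0" if l: "l \<in> \<Lambda>" for l
  proof -
    have "?e l \<in> f ` hcarrier ?M"
      using standard_basis_vector(1)[OF l] f unfolding bij_betw_def by blast
    then obtain b m where bm: "(b, m) \<in> hcarrier ?M" "f (b, m) = ?e l" by force
    then have m: "m \<in> hcarrier N" by (simp add: hmod_sum_def)
    have "S a l = Unitization (star b * a) 0" for a
    proof -
      have "S a l = hinner ?H (f (b, m)) (S a)"
        unfolding bm(2) standard_basis_vector(2)[OF l] ..
      also have "\<dots> = Unitization (star b * a) 0"
        unfolding S_def inner[OF bm(1) a_in] by (rule inner_a[OF m])
      finally show ?thesis .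
    qed
    then show ?thesis by blast
  qed
  then obtain g where g: "\<And>l a. l \<in> \<Lambda> \<Longrightarrow> S a l = Unitization (star (g l) * a) 0" by metis
  have "((\<lambda>l. star (star (g l) * a) * (star (g l) * a)) has_sum star a * a) \<Lambda>" for a
  proof -
    have inner_S: "hinner ?H (S a) (S a) = Unitization (star a * a) 0"
      unfolding S_def inner[OF a_in a_in] by (rule inner_a[OF N.zero_closed])
    have "S a \<in> hcarrier ?H"
      using f a_in unfolding S_def bij_betw_def by blast
    then have "((\<lambda>l. star (S a l) * S a l) has_sum hinner ?H (S a) (S a)) \<Lambda>"
      by (simp add: standard_module_def)
    then have "((\<lambda>l. star (S a l) * S a l) has_sum Unitization (star a * a) 0) \<Lambda>"
      unfolding inner_S .
    moreover have "star (S a l) * S a l = Unitization (star (star (g l) * a) * (star (g l) * a)) 0"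
      if "l \<in> \<Lambda>" for l
      by (rule unitization.expand) (simp add: g[OF that])
    ultimately have "((\<lambda>l. Unitization (star (star (g l) * a) * (star (g l) * a)) 0)
        has_sum Unitization (star a * a) 0) \<Lambda>"
      by (rule has_sum_cong[THEN iffD1, rotated])
    then show ?thesis by (simp only: has_sum_unitization_embed)
  qed
  then show ?thesis by blast
qed

theorem corollary5p2:
  fixes \<Lambda> :: "'l set"
  assumes "\<not> unital TYPE('a::cstar_algebra)"
    and "locally_unital TYPE('a)"
  shows "\<not> (\<exists>N :: ('a unitization, 'n) hmod.
    hilbert_module N \<and>
    hmod_isomorphic (hmod_sum (algebra_module :: ('a unitization, 'a) hmod) N) (standard_module \<Lambda>))"
proof
  assume "\<exists>N :: ('a unitization, 'n) hmod. hilbert_module N \<and>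
    hmod_isomorphic (hmod_sum (algebra_module :: ('a unitization, 'a) hmod) N) (standard_module \<Lambda>)"
  then obtain N :: "('a unitization, 'n) hmod" where "hilbert_module N"
    "hmod_isomorphic (hmod_sum (algebra_module :: ('a unitization, 'a) hmod) N) (standard_module \<Lambda>)"
    by blast
  then obtain g :: "'l \<Rightarrow> 'a" where
    "\<forall>a. ((\<lambda>l. star (star (g l) * a) * (star (g l) * a)) has_sum star a * a) \<Lambda>"
    using direct_summand_has_frame by blast
  then show False
    by (intro no_frame_if_locally_unital[OF assms]) (rule spec)
qed

end
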